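(* Let $l>0$ be a real number. There exists an equilateral triangle in $\mathbb{R}^3$ with side length $l$ all of whose vertices have integer coordinates if and only if $l=\sqrt{2(m^2-mn+n^2)}$ for some integers $m$ and $n$, not both zero. *)

theory Defs
  imports "HOL-Analysis.Analysis"
begin

end

theory Submission
  imports Defs
begin

text \<open>
  Write the edges of a lattice triangle of side \<open>\<surd>(2k)\<close> at one vertex as \<open>u\<close>, \<open>v\<close>, so that
  \<open>u \<bullet> u = v \<bullet> v = 2k\<close> and \<open>u \<bullet> v = k\<close>. With \<open>\<omega>\<close> a primitive cube root of unity, the vector
  \<open>z = u + \<omega>v\<close> over the Eisenstein integers is isotropic: \<open>z\<^sub>1\<^sup>2 + z\<^sub>2\<^sup>2 + z\<^sub>3\<^sup>2 = 0\<close>. Its discrete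
  Fourier coefficients \<open>\<alpha>, \<beta>, \<gamma>\<close> against \<open>(1,\<omega>,\<omega>\<^sup>2)\<close>, \<open>(1,\<omega>\<^sup>2,\<omega>)\<close>, \<open>(1,1,1)\<close> then satisfy
  \<open>\<gamma>\<^sup>2 = -2\<alpha>\<beta>\<close>, while Parseval gives \<open>|\<alpha>|\<^sup>2 + |\<beta>|\<^sup>2 + |\<gamma>|\<^sup>2 = 9k\<close>. Hence
  \<open>36k|\<alpha>|\<^sup>2 = (2|\<alpha>|\<^sup>2 + |\<gamma>|\<^sup>2)\<^sup>2\<close>, so \<open>k\<close> is a norm from \<open>\<rat>(\<omega>)\<close>, and since the Eisenstein
  integers are norm-Euclidean the Davenport--Cassels descent makes it the norm of an Eisenstein
  integer. Conversely, if \<open>k = m\<^sup>2 - mn + n\<^sup>2\<close>, the triangle is found in the plane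
  \<open>x + y + z = 0\<close>.
\<close>

definition eis_norm :: "int \<Rightarrow> int \<Rightarrow> int" where
  "eis_norm x y = x\<^sup>2 - x * y + y\<^sup>2"

lemma four_eis_norm: "4 * eis_norm x y = (2 * x - y)\<^sup>2 + 3 * y\<^sup>2"
  unfolding eis_norm_def by (simp add: power2_eq_square algebra_simps)

lemma eis_norm_nonneg: "0 \<le> eis_norm x y"
  using four_eis_norm[of x y] by (smt (verit) zero_le_power2)

lemma eis_norm_eq_0_iff: "eis_norm x y = 0 \<longleftrightarrow> x = 0 \<and> y = 0"
proof
  assume "eis_norm x y = 0"
  then have "(2 * x - y)\<^sup>2 + 3 * y\<^sup>2 = 0"
    using four_eis_norm[of x y] by simp
  then have "(2 * x - y)\<^sup>2 = 0" "y\<^sup>2 = 0"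
    using zero_le_power2[of "2 * x - y"] zero_le_power2[of y] by linarith+
  then show "x = 0 \<and> y = 0" by simp
qed (simp add: eis_norm_def)

lemma eis_norm_mult_left: "eis_norm (c * x) (c * y) = c\<^sup>2 * eis_norm x y"
  unfolding eis_norm_def by (simp add: power2_eq_square algebra_simps)

lemma nearest_multiple:
  fixes x D :: int
  assumes "D > 0"
  obtains y where "2 * \<bar>x - D * y\<bar> \<le> D"
proof (cases "2 * (x mod D) \<le> D")
  case True
  have "x - D * (x div D) = x mod D"
    by (simp add: minus_mult_div_eq_mod)
  with True assms show ?thesis
    using that[of "x div D"] by simp
next
  case False
  have "x - D * (x div D + 1) = x mod D - D"
    by (simp add: minus_mult_div_eq_mod algebra_simps)
  with False assms show ?thesis
    using that[of "x div D + 1"] pos_mod_bound[OF assms, of x] by simp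
qed

text \<open>Norm-Euclidean bound: a remainder rounded to the nearest multiple has norm at most
  \<open>3/4 * D\<^sup>2\<close>.\<close>

lemma eis_norm_less_square:
  assumes "D > 0" "2 * \<bar>r\<bar> \<le> D" "2 * \<bar>s\<bar> \<le> D"
  shows "eis_norm r s < D\<^sup>2"
proof -
  have r: "4 * r\<^sup>2 \<le> D\<^sup>2" and s: "4 * s\<^sup>2 \<le> D\<^sup>2"
    using power_mono[OF assms(2), of 2] power_mono[OF assms(3), of 2]
    by (simp_all add: power_mult_distrib)
  have "2 * eis_norm r s + (r + s)\<^sup>2 = 3 * r\<^sup>2 + 3 * s\<^sup>2"
    unfolding eis_norm_def by (simp add: power2_eq_square algebra_simps)
  then have "2 * eis_norm r s \<le> 3 * r\<^sup>2 + 3 * s\<^sup>2"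
    using zero_le_power2[of "r + s"] by linarith
  moreover have "D\<^sup>2 > 0" using assms(1) by simp
  ultimately show ?thesis using r s by linarith
qed

text \<open>
  Davenport--Cassels: with \<open>Y\<close> the lattice point nearest to \<open>X/D\<close>, the line through \<open>Y\<close> and
  \<open>X/D\<close> meets the conic of norm \<open>k\<close> in a second point, whose denominator divides
  \<open>D' = eis_norm (X - D Y) / D < D\<close>.
\<close>
lemma eis_norm_descent:
  fixes D k x y :: int
  assumes "D > 0" "k * D\<^sup>2 = eis_norm x y"
  shows "\<exists>m n. k = eis_norm m n"
  using assms
proof (induction "nat D" arbitrary: D x y rule: less_induct)
  case less
  note kD = less.prems(2)
  obtain p where p: "2 * \<bar>x - D * p\<bar> \<le> D" using nearest_multiple less.prems(1) .
  obtain q where q: "2 * \<bar>y - D * q\<bar> \<le> D" using nearest_multiple less.prems(1) .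
  \<comment> \<open>If \<open>D'\<close> is nonzero, the second point on the conic is
    \<open>(a * x + b * p, a * y + b * q)\<close> divided by \<open>D'\<close>.\<close>
  define a where "a = eis_norm p q - k"
  define b where "b = 2 * k * D - (2 * x * p - x * q - y * p + 2 * y * q)"
  define D' where "D' = a * D + b"
  have DD': "D * D' = eis_norm (x - D * p) (y - D * q)"
    using kD unfolding D'_def a_def b_def eis_norm_def by algebra
  have k': "k * D'\<^sup>2 = eis_norm (a * x + b * p) (a * y + b * q)"
    using kD unfolding D'_def a_def b_def eis_norm_def by algebra
  have "D * D' < D * D"
    using eis_norm_less_square[OF less.prems(1) p q] DD' by (simp add: power2_eq_square)
  then have "D' < D" using less.prems(1) by simp
  have "0 \<le> D'"
    using eis_norm_nonneg[of "x - D * p" "y - D * q"] DD' less.prems(1)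
    by (metis zero_le_mult_iff not_le)
  show ?case
  proof (cases "D' = 0")
    case True
    then have "x = D * p" "y = D * q"
      using DD' by (simp_all add: eis_norm_eq_0_iff)
    then have "k = eis_norm p q"
      using kD less.prems(1) by (simp add: eis_norm_mult_left)
    then show ?thesis by blast
  next
    case False
    then show ?thesis
      using less.hyps[of D'] \<open>D' < D\<close> \<open>0 \<le> D'\<close> k' less.prems(1) by simp
  qed
qed

lemma eis_norm_of_square_mult:
  fixes D k x y :: int
  assumes "D \<noteq> 0" "k * D\<^sup>2 = eis_norm x y"
  shows "\<exists>m n. k = eis_norm m n"
  using eis_norm_descent[of "\<bar>D\<bar>" k x y] assms by simp

text \<open>
  Below \<open>(a, b)\<close>, \<open>(c, d)\<close>, \<open>(e, f)\<close> are the coordinates of \<open>\<alpha>\<close>, \<open>\<beta>\<close>, \<open>\<gamma>\<close> in the basis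
  \<open>1, \<omega>\<close>; the assertions \<open>re\<close> and \<open>im\<close> are the two coordinates of \<open>\<gamma>\<^sup>2 = -2\<alpha>\<beta>\<close>.
\<close>
lemma eis_norm_of_lattice_triangle:
  fixes u1 u2 u3 v1 v2 v3 k :: int
  assumes uu: "u1\<^sup>2 + u2\<^sup>2 + u3\<^sup>2 = 2 * k"
    and vv: "v1\<^sup>2 + v2\<^sup>2 + v3\<^sup>2 = 2 * k"
    and uv: "u1 * v1 + u2 * v2 + u3 * v3 = k"
  shows "\<exists>m n. k = eis_norm m n"
proof -
  define a b where "a = u1 - v2 + v3 - u3" and "b = v1 + u2 - v2 - u3"
  define c d where "c = u1 - v3 + v2 - u2" and "d = v1 + u3 - v3 - u2"
  define e f where "e = u1 + u2 + u3" and "f = v1 + v2 + v3"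
  have re: "e\<^sup>2 - f\<^sup>2 = - 2 * (a * c - b * d)"
    using uu vv uv unfolding a_def b_def c_def d_def e_def f_def by algebra
  have im: "2 * e * f - f\<^sup>2 = - 2 * (a * d + b * c - b * d)"
    using uu vv uv unfolding a_def b_def c_def d_def e_def f_def by algebra
  have prod: "(eis_norm e f)\<^sup>2 = 4 * (eis_norm a b * eis_norm c d)"
  proof -
    have "(eis_norm e f)\<^sup>2 = eis_norm (e\<^sup>2 - f\<^sup>2) (2 * e * f - f\<^sup>2)"
      unfolding eis_norm_def by algebra
    also have "\<dots> = 4 * (eis_norm a b * eis_norm c d)"
      unfolding re im unfolding eis_norm_def by algebra
    finally show ?thesis .
  qed
  have parseval: "eis_norm a b + eis_norm c d + eis_norm e f = 9 * k"
    using uu vv uv unfolding a_def b_def c_def d_def e_def f_def eis_norm_def by algebra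
  show ?thesis
  proof (cases "eis_norm a b = 0")
    \<comment> \<open>Here \<alpha> = 0 forces \<gamma> = 0, so Parseval leaves only the norm of
      \<beta>.\<close>
    case True
    then have "k * 3\<^sup>2 = eis_norm c d"
      using prod parseval by simp
    then show ?thesis
      using eis_norm_of_square_mult[of 3] by simp
  next
    case False
    define s where "s = 2 * eis_norm a b + eis_norm e f"
    have "36 * k * eis_norm a b = s\<^sup>2"
      using prod parseval unfolding s_def by algebra
    then have "k * (6 * eis_norm a b)\<^sup>2 = eis_norm (s * a) (s * b)"
      unfolding eis_norm_mult_left by algebra
    then show ?thesis
      by (rule eis_norm_of_square_mult[rotated]) (use False in simp)
  qed
qed

lemma dist_sq_vec3:
  fixes A B :: "real ^ 3"
  shows "(dist A B)\<^sup>2 = (A $ 1 - B $ 1)\<^sup>2 + (A $ 2 - B $ 2)\<^sup>2 + (A $ 3 - B $ 3)\<^sup>2"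
  unfolding dist_norm power2_norm_eq_inner inner_vec_def
  by (simp add: sum_3 power2_eq_square)

theorem theorem5p3:
  fixes l :: real
  assumes "l > 0"
  shows "(\<exists>A B C :: real ^ 3.
            dist A B = l \<and> dist B C = l \<and> dist C A = l \<and>
            (\<forall>i. A $ i \<in> \<int>) \<and> (\<forall>i. B $ i \<in> \<int>) \<and> (\<forall>i. C $ i \<in> \<int>))
         \<longleftrightarrow>
         (\<exists>m n :: int. \<not> (m = 0 \<and> n = 0) \<and>
            l = sqrt (real_of_int (2 * (m\<^sup>2 - m * n + n\<^sup>2))))"
proof
  assume "\<exists>A B C :: real ^ 3.
            dist A B = l \<and> dist B C = l \<and> dist C A = l \<and>
            (\<forall>i. A $ i \<in> \<int>) \<and> (\<forall>i. B $ i \<in> \<int>) \<and> (\<forall>i. C $ i \<in> \<int>)"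
  then obtain A B C :: "real ^ 3"
    where AB: "dist A B = l" and BC: "dist B C = l" and CA: "dist C A = l"
      and int: "\<forall>i. A $ i \<in> \<int>" "\<forall>i. B $ i \<in> \<int>" "\<forall>i. C $ i \<in> \<int>"
    by blast
  have "\<forall>i. \<exists>z. B $ i - A $ i = of_int z" "\<forall>i. \<exists>z. C $ i - A $ i = of_int z"
    using int by (meson Ints_cases Ints_diff)+
  then obtain u v :: "3 \<Rightarrow> int"
    where u: "\<And>i. B $ i - A $ i = of_int (u i)" and v: "\<And>i. C $ i - A $ i = of_int (v i)"
    by metis
  have w: "B $ i - C $ i = of_int (u i - v i)" for i
    using u[of i] v[of i] by simp
  define N where "N = (u 1)\<^sup>2 + (u 2)\<^sup>2 + (u 3)\<^sup>2"
  define k where "k = u 1 * v 1 + u 2 * v 2 + u 3 * v 3"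
  have lN: "l\<^sup>2 = of_int N"
    using dist_sq_vec3[of B A] AB unfolding u N_def by (simp add: dist_commute)
  have "l\<^sup>2 = of_int ((v 1)\<^sup>2 + (v 2)\<^sup>2 + (v 3)\<^sup>2)"
    using dist_sq_vec3[of C A] CA unfolding v by simp
  then have vN: "(v 1)\<^sup>2 + (v 2)\<^sup>2 + (v 3)\<^sup>2 = N"
    using lN by (metis of_int_eq_iff)
  have "l\<^sup>2 = of_int ((u 1 - v 1)\<^sup>2 + (u 2 - v 2)\<^sup>2 + (u 3 - v 3)\<^sup>2)"
    using dist_sq_vec3[of B C] BC unfolding w by simp
  then have "(u 1 - v 1)\<^sup>2 + (u 2 - v 2)\<^sup>2 + (u 3 - v 3)\<^sup>2 = N"
    using lN by (metis of_int_eq_iff)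
  then have Nk: "N = 2 * k"
    using vN unfolding N_def k_def by algebra
  obtain m n where mn: "k = eis_norm m n"
    using eis_norm_of_lattice_triangle[of "u 1" "u 2" "u 3" k "v 1" "v 2" "v 3"] vN Nk
    unfolding N_def k_def by auto
  have "l\<^sup>2 = real_of_int (2 * (m\<^sup>2 - m * n + n\<^sup>2))"
    using lN unfolding Nk mn eis_norm_def .
  then have l: "l = sqrt (real_of_int (2 * (m\<^sup>2 - m * n + n\<^sup>2)))"
    using assms by (metis real_sqrt_unique less_imp_le)
  then have "\<not> (m = 0 \<and> n = 0)"
    using assms by auto
  with l show "\<exists>m n :: int. \<not> (m = 0 \<and> n = 0) \<and>
      l = sqrt (real_of_int (2 * (m\<^sup>2 - m * n + n\<^sup>2)))"
    by blast
next
  assume "\<exists>m n :: int. \<not> (m = 0 \<and> n = 0) \<and>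
      l = sqrt (real_of_int (2 * (m\<^sup>2 - m * n + n\<^sup>2)))"
  then obtain m n :: int where l: "l = sqrt (real_of_int (2 * (m\<^sup>2 - m * n + n\<^sup>2)))"
    by blast
  define x y where "x = real_of_int m" and "y = real_of_int n"
  \<comment> \<open>\<open>C\<close> is the negated cyclic shift of \<open>B\<close>, that is,
    \<open>B\<close> turned by 60 degrees in the plane of coordinate sum zero.\<close>
  define A B C :: "real ^ 3"
    where "A = vector [0, 0, 0]" and "B = vector [x, - y, y - x]" and "C = vector [y, x - y, - x]"
  have lxy: "l = sqrt (2 * (x\<^sup>2 - x * y + y\<^sup>2))"
    unfolding l x_def y_def by simp
  have len: "dist P Q = l" if "(dist P Q)\<^sup>2 = 2 * (x\<^sup>2 - x * y + y\<^sup>2)" for P Q :: "real ^ 3"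
    using that lxy by (metis real_sqrt_unique zero_le_dist)
  have "dist A B = l" "dist B C = l" "dist C A = l"
    by (rule len, unfold dist_sq_vec3 A_def B_def C_def vector_3, algebra)+
  moreover have "\<forall>i. A $ i \<in> \<int>" "\<forall>i. B $ i \<in> \<int>" "\<forall>i. C $ i \<in> \<int>"
    unfolding A_def B_def C_def x_def y_def by (simp_all add: forall_3)
  ultimately show "\<exists>A B C :: real ^ 3.
            dist A B = l \<and> dist B C = l \<and> dist C A = l \<and>
            (\<forall>i. A $ i \<in> \<int>) \<and> (\<forall>i. B $ i \<in> \<int>) \<and> (\<forall>i. C $ i \<in> \<int>)"
    by blast
qed

end
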